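(* Let $(A,\Phi)$ be a $\mathcal{C}^{\infty}$-ring and let $\{ (A_{\alpha}, \Phi_{\alpha}) \mid \alpha \in \Lambda\}$, $\Lambda \neq \varnothing$, be a directed family of $\mathcal{C}^{\infty}$-subrings of $(A,\Phi)$, that is, a family such that for every pair $(\alpha, \beta) \in \Lambda \times \Lambda$ there is some $\gamma \in \Lambda$ such that $A_{\alpha} \subseteq A_{\gamma}$ and $A_{\beta} \subseteq A_{\gamma}$. Then $\left( \bigcup_{\alpha \in \Lambda} A_{\alpha}, \Phi'\right)$, where for each $n\in\mathbb{N}$ and $f\in\mathcal{C}^{\infty}(\mathbb{R}^n,\mathbb{R})$ $$\Phi'(f)=\Phi(f)\upharpoonright_{\left(\bigcup_{\alpha \in \Lambda} A_{\alpha}\right)^n}: \Big( \bigcup_{\alpha \in \Lambda} A_{\alpha}\Big)^n \to \bigcup_{\alpha \in \Lambda} A_{\alpha},$$ is a $\mathcal{C}^{\infty}$-subring of $(A,\Phi)$.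
   Context: $\mathbb{N}=\{0,1,2,\dots\}$. A $\mathcal{C}^{\infty}$-structure is a pair $(A,\Phi)$, where $A$ is a set and $\Phi$ assigns to each $n\in\mathbb{N}$ and each smooth function $f\in\mathcal{C}^{\infty}(\mathbb{R}^n,\mathbb{R})$ a function $\Phi(f):A^n\to A$. It is a $\mathcal{C}^{\infty}$-ring if (1) for each $n$ and $k\le n$, the projection $p_k:\mathbb{R}^n\to\mathbb{R}$ onto the $k$-th coordinate is sent to the projection $\pi_k:A^n\to A$ onto the $k$-th coordinate; and (2) whenever $f\in\mathcal{C}^{\infty}(\mathbb{R}^n,\mathbb{R})$, $g_1,\dots,g_n,h\in\mathcal{C}^{\infty}(\mathbb{R}^k,\mathbb{R})$ and $h=f\circ(g_1,\dots,g_n)$, then $\Phi(h)=\Phi(f)\circ(\Phi(g_1),\dots,\Phi(g_n))$. For $B\subseteq A$, $(B,\Phi')$ is a $\mathcal{C}^{\infty}$-subring of $(A,\Phi)$ if for all $n\in\mathbb{N}$, $f\in\mathcal{C}^{\infty}(\mathbb{R}^n,\mathbb{R})$ and $(b_1,\dots,b_n)\in B^n$ one has $\Phi(f)(b_1,\dots,b_n)\in B$, where $\Phi'(f)=\Phi(f)\upharpoonright_{B^n}:B^n\to B$. *)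

theory Defs
  imports "HOL-Analysis.Analysis"
begin

text \<open>
  The \<^term>\<open>n\<close>-fold power of a set: families indexed by \<open>0, \<dots>, n - 1\<close>, with value
  \<^const>\<open>undefined\<close> off the index set, so that equality is equality of tuples (and the power
  with exponent \<open>0\<close> is a singleton). For \<open>X = (UNIV :: real set)\<close>, the subspace topology
  inherited from the product topology on \<^typ>\<open>nat \<Rightarrow> real\<close> is the Euclidean one.
\<close>

definition tuples :: "nat \<Rightarrow> 'a set \<Rightarrow> (nat \<Rightarrow> 'a) set" where
  "tuples n X = {..<n} \<rightarrow>\<^sub>E X"

abbreviation Rn :: "nat \<Rightarrow> (nat \<Rightarrow> real) set" where
  "Rn n \<equiv> tuples n UNIV"

definition has_partial_deriv ::
    "nat \<Rightarrow> nat \<Rightarrow> ((nat \<Rightarrow> real) \<Rightarrow> real) \<Rightarrow> ((nat \<Rightarrow> real) \<Rightarrow> real) \<Rightarrow> bool" where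
  "has_partial_deriv n i f g \<longleftrightarrow>
     (\<forall>x\<in>Rn n. ((\<lambda>t. f (x(i := t))) has_real_derivative g x) (at (x i)))"

text \<open>\<open>C_k k n f\<close>: all partial derivatives of \<open>f\<close> of order at most \<open>k\<close> exist and are continuous
  on the whole of \<open>Rn n\<close>.\<close>

primrec C_k :: "nat \<Rightarrow> nat \<Rightarrow> ((nat \<Rightarrow> real) \<Rightarrow> real) \<Rightarrow> bool" where
  "C_k 0 n f \<longleftrightarrow> continuous_on (Rn n) f"
| "C_k (Suc k) n f \<longleftrightarrow> continuous_on (Rn n) f \<and>
     (\<forall>i<n. \<exists>g. has_partial_deriv n i f g \<and> C_k k n g)"

text \<open>Functions on \<open>Rn n\<close> are normalised to be \<^const>\<open>undefined\<close> elsewhere, so that equality is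
  equality of functions on \<open>Rn n\<close>.\<close>

definition C_inf :: "nat \<Rightarrow> ((nat \<Rightarrow> real) \<Rightarrow> real) set" where
  "C_inf n = {f \<in> Rn n \<rightarrow>\<^sub>E UNIV. \<forall>k. C_k k n f}"

definition tuple_proj :: "nat \<Rightarrow> 'a set \<Rightarrow> nat \<Rightarrow> (nat \<Rightarrow> 'a) \<Rightarrow> 'a" where
  "tuple_proj n X k = (\<lambda>x\<in>tuples n X. x k)"

text \<open>\<open>comp_tuple n k X f g\<close> is the composite \<open>f \<circ> (g 0, \<dots>, g (n - 1))\<close> on the \<open>k\<close>-th power
  of \<open>X\<close>.\<close>

definition comp_tuple ::
    "nat \<Rightarrow> nat \<Rightarrow> 'a set \<Rightarrow> ((nat \<Rightarrow> 'a) \<Rightarrow> 'a) \<Rightarrow> (nat \<Rightarrow> (nat \<Rightarrow> 'a) \<Rightarrow> 'a) \<Rightarrow> (nat \<Rightarrow> 'a) \<Rightarrow> 'a" where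
  "comp_tuple n k X f g = (\<lambda>x\<in>tuples k X. f (\<lambda>i\<in>{..<n}. g i x))"

text \<open>An interpretation sends an arity \<open>n\<close> and a smooth \<open>f \<in> C_inf n\<close> to an \<open>n\<close>-ary operation.
  Its values at functions outside \<open>C_inf n\<close> carry no meaning.\<close>

type_synonym 'a interp = "nat \<Rightarrow> ((nat \<Rightarrow> real) \<Rightarrow> real) \<Rightarrow> (nat \<Rightarrow> 'a) \<Rightarrow> 'a"

definition cinf_structure :: "'a set \<Rightarrow> 'a interp \<Rightarrow> bool" where
  "cinf_structure A \<Phi> \<longleftrightarrow> (\<forall>n. \<forall>f\<in>C_inf n. \<Phi> n f \<in> tuples n A \<rightarrow>\<^sub>E A)"

definition cinf_ring :: "'a set \<Rightarrow> 'a interp \<Rightarrow> bool" where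
  "cinf_ring A \<Phi> \<longleftrightarrow> cinf_structure A \<Phi> \<and>
     (\<forall>n. \<forall>k<n. \<Phi> n (tuple_proj n UNIV k) = tuple_proj n A k) \<and>
     (\<forall>n k. \<forall>f\<in>C_inf n. \<forall>g. \<forall>h\<in>C_inf k. (\<forall>i<n. g i \<in> C_inf k) \<longrightarrow>
        h = comp_tuple n k UNIV f g \<longrightarrow>
        \<Phi> k h = comp_tuple n k A (\<Phi> n f) (\<lambda>i. \<Phi> k (g i)))"

definition restrict_interp :: "'a interp \<Rightarrow> 'a set \<Rightarrow> 'a interp" where
  "restrict_interp \<Phi> B = (\<lambda>n f. restrict (\<Phi> n f) (tuples n B))"

definition cinf_subring :: "'a set \<Rightarrow> 'a interp \<Rightarrow> 'a set \<Rightarrow> 'a interp \<Rightarrow> bool" where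
  "cinf_subring B \<Phi>' A \<Phi> \<longleftrightarrow> B \<subseteq> A \<and>
     (\<forall>n. \<forall>f\<in>C_inf n. \<forall>b\<in>tuples n B. \<Phi> n f b \<in> B) \<and>
     (\<forall>n. \<forall>f\<in>C_inf n. \<Phi>' n f = restrict_interp \<Phi> B n f)"

end

theory Submission
  imports Defs
begin

text \<open>Smooth operations are finitary: an argument of \<open>\<Phi> n f\<close> has only n
  entries. Each entry from the union lies in some member of the family, and directedness, used
  finitely often, puts all of them into a single member (\<open>finite_subset_directed_UN\<close>).
  That member is closed under \<open>\<Phi> n f\<close>, so the value lies in it and hence in the
  union.\<close>

lemma finite_subset_directed_UN:
  assumes "finite S" "S \<subseteq> (\<Union>\<alpha>\<in>I. F \<alpha>)" "I \<noteq> {}"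
    and directed: "\<forall>\<alpha>\<in>I. \<forall>\<beta>\<in>I. \<exists>\<gamma>\<in>I. F \<alpha> \<subseteq> F \<gamma> \<and> F \<beta> \<subseteq> F \<gamma>"
  obtains \<gamma> where "\<gamma> \<in> I" "S \<subseteq> F \<gamma>"
proof -
  from assms(1,2) have "\<exists>\<gamma>\<in>I. S \<subseteq> F \<gamma>"
  proof (induction S)
    case empty
    \<comment> \<open>For arity 0 the set of entries is empty, so this case is what places the
      constants \<open>\<Phi> 0 f\<close> in the union.\<close>
    then show ?case using \<open>I \<noteq> {}\<close> by auto
  next
    case (insert x S)
    then obtain \<alpha> \<beta> where "\<alpha> \<in> I" "S \<subseteq> F \<alpha>" "\<beta> \<in> I" "x \<in> F \<beta>" by auto
    moreover from this directed obtain \<gamma> where "\<gamma> \<in> I" "F \<alpha> \<subseteq> F \<gamma>" "F \<beta> \<subseteq> F \<gamma>" by blast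
    ultimately show ?case by blast
  qed
  then show thesis using that by blast
qed

theorem proposition2:
  fixes A :: "'a set" and \<Phi> :: "'a interp"
    and \<Lambda> :: "'i set" and A_fam :: "'i \<Rightarrow> 'a set" and \<Phi>_fam :: "'i \<Rightarrow> 'a interp"
  assumes "cinf_ring A \<Phi>"
    and "\<Lambda> \<noteq> {}"
    and "\<forall>\<alpha>\<in>\<Lambda>. cinf_subring (A_fam \<alpha>) (\<Phi>_fam \<alpha>) A \<Phi>"
    and "\<forall>\<alpha>\<in>\<Lambda>. \<forall>\<beta>\<in>\<Lambda>. \<exists>\<gamma>\<in>\<Lambda>. A_fam \<alpha> \<subseteq> A_fam \<gamma> \<and> A_fam \<beta> \<subseteq> A_fam \<gamma>"
  shows "cinf_subring (\<Union>\<alpha>\<in>\<Lambda>. A_fam \<alpha>) (restrict_interp \<Phi> (\<Union>\<alpha>\<in>\<Lambda>. A_fam \<alpha>)) A \<Phi>"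
proof -
  let ?U = "\<Union>\<alpha>\<in>\<Lambda>. A_fam \<alpha>"
  have "\<Phi> n f b \<in> ?U" if f: "f \<in> C_inf n" and b: "b \<in> tuples n ?U" for n f b
  proof -
    have "b ` {..<n} \<subseteq> ?U"
      using b by (auto simp: tuples_def PiE_iff)
    then obtain \<gamma> where \<gamma>: "\<gamma> \<in> \<Lambda>" "b ` {..<n} \<subseteq> A_fam \<gamma>"
      by (rule finite_subset_directed_UN[OF finite_imageI[OF finite_lessThan] _ assms(2,4)])
    \<comment> \<open>Only the entries need checking: the value \<open>undefined\<close> off
      \<open>{..<n}\<close> carries over from b as a tuple over \<open>?U\<close>.\<close>
    then have "b \<in> tuples n (A_fam \<gamma>)"
      using b by (auto simp: tuples_def PiE_iff)
    then show ?thesis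
      using \<gamma>(1) f assms(3) unfolding cinf_subring_def by blast
  qed
  moreover have "?U \<subseteq> A"
    using assms(3) unfolding cinf_subring_def by blast
  \<comment> \<open>The remaining clause, on the interpretation of the union, is an instance of
    reflexivity.\<close>
  ultimately show ?thesis
    unfolding cinf_subring_def by blast
qed

end
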